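(* Let $\mathcal{P} = \langle X : R\rangle$ be a presentation of the inverse monoid $M$, where $R$ is a set of pairs $(\ell,r)$ with $\ell,r\in \mathrm{FIM}(X)$, so that $M\cong \mathrm{FIM}(X)/{\simeq_{\mathcal{P}}}$ where $\simeq_{\mathcal{P}}$ is the congruence on $\mathrm{FIM}(X)$ generated by $R$. Let $K(\mathcal{P})$ be the kernel of $\simeq_{\mathcal{P}}$, and let $N(\mathcal{P})$ be the smallest normal inverse subsemigroup of $\mathrm{FIM}(X)$ containing $\{\ell^{-1}r,\ \ell r^{-1} : (\ell,r)\in R\}$. Then $M$ is $E$-unitary if and only if $K(\mathcal{P})$ is a closed inverse submonoid of $\mathrm{FIM}(X)$, in which case $K(\mathcal{P})=N(\mathcal{P})^{\uparrow}$.
   Context: $\mathrm{FIM}(X)$ is the free inverse monoid on the set $X$. For an inverse semigroup $S$ with semilattice of idempotents $E(S)$, the kernel of a congruence $\rho$ on $S$ is $\{s\in S : s\mathrel{\rho}e\text{ for some }e\in E(S)\}$. An inverse subsemigroup $N$ of $S$ is normal if $E(N)=E(S)$ and $s^{-1}ns\in N$ for all $s\in S$, $n\in N$. A subset $A\subseteq S$ is closed if $a\in A$ and $a\leq s$ (natural partial order) imply $s\in A$; $A^{\uparrow}$ is the smallest closed subset containing $A$. An inverse semigroup $M$ is $E$-unitary if whenever $e\in E(M)$, $m\in M$ and $e\leq m$, then $m\in E(M)$. *)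

theory Defs
  imports "HOL-Algebra.Group"
begin

definition is_sinv :: "('a, 'b) monoid_scheme \<Rightarrow> 'a \<Rightarrow> 'a \<Rightarrow> bool" where
  "is_sinv S a b \<longleftrightarrow> b \<in> carrier S \<and> a \<otimes>\<^bsub>S\<^esub> b \<otimes>\<^bsub>S\<^esub> a = a \<and> b \<otimes>\<^bsub>S\<^esub> a \<otimes>\<^bsub>S\<^esub> b = b"

locale inverse_monoid = monoid S for S (structure) +
  assumes ex1_sinv: "a \<in> carrier S \<Longrightarrow> \<exists>!b. is_sinv S a b"

text \<open>The inverse in the sense of inverse semigroups. It must not be confused with the
  library's \<open>m_inv\<close>, which is only meaningful on the group of units.\<close>

definition sinv :: "('a, 'b) monoid_scheme \<Rightarrow> 'a \<Rightarrow> 'a" where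
  "sinv S a = (THE b. is_sinv S a b)"

definition idempotents :: "('a, 'b) monoid_scheme \<Rightarrow> 'a set" where
  "idempotents S = {e \<in> carrier S. e \<otimes>\<^bsub>S\<^esub> e = e}"

text \<open>The natural partial order of an inverse semigroup: the restrictions of \<open>s\<close> by idempotents
  lie below \<open>s\<close>.\<close>

definition nat_le :: "('a, 'b) monoid_scheme \<Rightarrow> 'a \<Rightarrow> 'a \<Rightarrow> bool" where
  "nat_le S a s \<longleftrightarrow> a \<in> carrier S \<and> s \<in> carrier S \<and> (\<exists>e \<in> idempotents S. a = e \<otimes>\<^bsub>S\<^esub> s)"

definition E_unitary :: "('a, 'b) monoid_scheme \<Rightarrow> bool" where
  "E_unitary S \<longleftrightarrow> inverse_monoid S \<and>
     (\<forall>e \<in> idempotents S. \<forall>m \<in> carrier S. nat_le S e m \<longrightarrow> m \<in> idempotents S)"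

definition upward_closed :: "('a, 'b) monoid_scheme \<Rightarrow> 'a set \<Rightarrow> bool" where
  "upward_closed S A \<longleftrightarrow> A \<subseteq> carrier S \<and> (\<forall>a \<in> A. \<forall>s \<in> carrier S. nat_le S a s \<longrightarrow> s \<in> A)"

definition upward_closure :: "('a, 'b) monoid_scheme \<Rightarrow> 'a set \<Rightarrow> 'a set" where
  "upward_closure S A = \<Inter>{C. upward_closed S C \<and> A \<subseteq> C}"

definition inverse_subsemigroup :: "('a, 'b) monoid_scheme \<Rightarrow> 'a set \<Rightarrow> bool" where
  "inverse_subsemigroup S N \<longleftrightarrow> N \<subseteq> carrier S \<and>
     (\<forall>a \<in> N. \<forall>b \<in> N. a \<otimes>\<^bsub>S\<^esub> b \<in> N) \<and> (\<forall>a \<in> N. sinv S a \<in> N)"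

definition inverse_submonoid :: "('a, 'b) monoid_scheme \<Rightarrow> 'a set \<Rightarrow> bool" where
  "inverse_submonoid S N \<longleftrightarrow> submonoid N S \<and> inverse_subsemigroup S N"

definition normal_inverse_subsemigroup :: "('a, 'b) monoid_scheme \<Rightarrow> 'a set \<Rightarrow> bool" where
  "normal_inverse_subsemigroup S N \<longleftrightarrow> inverse_subsemigroup S N \<and>
     idempotents (S\<lparr>carrier := N\<rparr>) = idempotents S \<and>
     (\<forall>s \<in> carrier S. \<forall>n \<in> N. sinv S s \<otimes>\<^bsub>S\<^esub> n \<otimes>\<^bsub>S\<^esub> s \<in> N)"

definition normal_inverse_hull :: "('a, 'b) monoid_scheme \<Rightarrow> 'a set \<Rightarrow> 'a set" where
  "normal_inverse_hull S A = \<Inter>{N. normal_inverse_subsemigroup S N \<and> A \<subseteq> N}"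

definition congruence :: "('a, 'b) monoid_scheme \<Rightarrow> 'a rel \<Rightarrow> bool" where
  "congruence S \<rho> \<longleftrightarrow> equiv (carrier S) \<rho> \<and>
     (\<forall>(a, b) \<in> \<rho>. \<forall>c \<in> carrier S.
        (c \<otimes>\<^bsub>S\<^esub> a, c \<otimes>\<^bsub>S\<^esub> b) \<in> \<rho> \<and> (a \<otimes>\<^bsub>S\<^esub> c, b \<otimes>\<^bsub>S\<^esub> c) \<in> \<rho>)"

definition generated_congruence :: "('a, 'b) monoid_scheme \<Rightarrow> 'a rel \<Rightarrow> 'a rel" where
  "generated_congruence S R = \<Inter>{\<rho>. congruence S \<rho> \<and> R \<subseteq> \<rho>}"

definition quotient_monoid :: "('a, 'b) monoid_scheme \<Rightarrow> 'a rel \<Rightarrow> 'a set monoid" where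
  "quotient_monoid S \<rho> =
     \<lparr>carrier = carrier S // \<rho>,
      mult = (\<lambda>A B. \<Union>a \<in> A. \<Union>b \<in> B. \<rho> `` {a \<otimes>\<^bsub>S\<^esub> b}),
      one = \<rho> `` {\<one>\<^bsub>S\<^esub>}\<rparr>"

definition congruence_kernel :: "('a, 'b) monoid_scheme \<Rightarrow> 'a rel \<Rightarrow> 'a set" where
  "congruence_kernel S \<rho> = {s \<in> carrier S. \<exists>e \<in> idempotents S. (s, e) \<in> \<rho>}"

text \<open>A word over \<open>X \<union> X\<^sup>-\<^sup>1\<close> is a list of signed letters: \<open>(x, True)\<close> stands for \<open>x\<close>
  and \<open>(x, False)\<close> for the formal inverse of \<open>x\<close>.\<close>

type_synonym 'x word = "('x \<times> bool) list"

definition word_monoid :: "'x set \<Rightarrow> 'x word monoid" where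
  "word_monoid X = \<lparr>carrier = lists (X \<times> UNIV), mult = (@), one = []\<rparr>"

definition word_inv :: "'x word \<Rightarrow> 'x word" where
  "word_inv w = rev (map (\<lambda>(x, b). (x, \<not> b)) w)"

definition vagner_relation :: "'x set \<Rightarrow> 'x word rel" where
  "vagner_relation X =
     {(w @ word_inv w @ w, w) | w. w \<in> lists (X \<times> UNIV)} \<union>
     {(u @ word_inv u @ v @ word_inv v, v @ word_inv v @ u @ word_inv u) | u v.
        u \<in> lists (X \<times> UNIV) \<and> v \<in> lists (X \<times> UNIV)}"

text \<open>The free inverse monoid, as the quotient of the free monoid with involution by the
  Vagner congruence.\<close>

definition FIM :: "'x set \<Rightarrow> 'x word set monoid" where
  "FIM X = quotient_monoid (word_monoid X)
     (generated_congruence (word_monoid X) (vagner_relation X))"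

definition pres_congruence :: "'x set \<Rightarrow> 'x word set rel \<Rightarrow> 'x word set rel" where
  "pres_congruence X R = generated_congruence (FIM X) R"

definition presents ::
  "'x set \<Rightarrow> 'x word set rel \<Rightarrow> ('m, 'b) monoid_scheme \<Rightarrow> bool" where
  "presents X R M \<longleftrightarrow> inverse_monoid M \<and> R \<subseteq> carrier (FIM X) \<times> carrier (FIM X) \<and>
     M \<cong> quotient_monoid (FIM X) (pres_congruence X R)"

definition pres_kernel :: "'x set \<Rightarrow> 'x word set rel \<Rightarrow> 'x word set set" where
  "pres_kernel X R = congruence_kernel (FIM X) (pres_congruence X R)"

definition pres_normal :: "'x set \<Rightarrow> 'x word set rel \<Rightarrow> 'x word set set" where
  "pres_normal X R = normal_inverse_hull (FIM X)
     (\<Union>(l, r) \<in> R. {sinv (FIM X) l \<otimes>\<^bsub>FIM X\<^esub> r, l \<otimes>\<^bsub>FIM X\<^esub> sinv (FIM X) r})"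

end

theory Submission
  imports Defs
begin

text \<open>Write \<open>S = FIM X\<close>, let \<open>\<rho>\<close> be the congruence generated by \<open>R\<close>, and let \<open>h\<close> be the
  projection of \<open>S\<close> onto \<open>M\<close>. An element lies in the kernel \<open>K\<close> iff its image under \<open>h\<close> is
  idempotent (\<open>s \<rho> s\<^sup>\<star> s\<close> for such \<open>s\<close>). As \<open>e \<le> m\<close> in \<open>M\<close> lifts to \<open>f a \<in> K\<close>, \<open>f a \<le> a\<close> with
  \<open>f\<close> idempotent and \<open>h a = m\<close>, closedness of \<open>K\<close> is exactly \<open>E\<close>-unitarity of \<open>M\<close>. The kernel
  is a normal inverse submonoid containing the given generators of \<open>N\<close>, so \<open>N\<^sup>\<up> \<subseteq> K\<close> when \<open>K\<close>
  is closed. Conversely, for \<open>C = N\<^sup>\<up>\<close> the relation \<open>a b\<^sup>\<star> \<in> C\<close> is a (group) congruence containing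
  \<open>R\<close>, hence \<open>\<rho>\<close>; so \<open>s \<rho> e\<close> gives \<open>s e \<in> C\<close> and \<open>s e \<le> s\<close> gives \<open>s \<in> C\<close>.\<close>

section \<open>Inverse monoids\<close>

lemma idempotents_iff: "e \<in> idempotents S \<longleftrightarrow> e \<in> carrier S \<and> e \<otimes>\<^bsub>S\<^esub> e = e"
  by (simp add: idempotents_def)

text \<open>The inverse is given as a relation \<open>P\<close>, since on the free inverse monoid it comes from
  words and one would otherwise have to show that it respects the Vagner congruence.\<close>

lemma inverse_monoidI:
  fixes S (structure)
  assumes "monoid S"
    and clos: "\<And>a b. P a b \<Longrightarrow> a \<in> carrier S \<and> b \<in> carrier S"
    and ex: "\<And>a. a \<in> carrier S \<Longrightarrow> \<exists>b. P a b"
    and sym: "\<And>a b. P a b \<Longrightarrow> P b a"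
    and reg: "\<And>a b. P a b \<Longrightarrow> a \<otimes> b \<otimes> a = a"
    and comm: "\<And>a b c d. P a b \<Longrightarrow> P c d \<Longrightarrow> (a \<otimes> b) \<otimes> (c \<otimes> d) = (c \<otimes> d) \<otimes> (a \<otimes> b)"
  shows "inverse_monoid S"
proof -
  interpret monoid S by fact
  \<comment> \<open>An idempotent \<open>e\<close> turns out to equal any \<open>f\<close> with
    \<open>P e f\<close>. Regularity gives
    \<open>f = (f \<otimes> e) \<otimes> (e \<otimes> f)\<close>; \<open>comm\<close> swaps the two
    factors, so \<open>f\<close> absorbs \<open>e\<close> on both sides, and
    \<open>e = e \<otimes> f \<otimes> e\<close> collapses to \<open>f\<close>. Thus
    \<open>e\<close> has the form of the products that \<open>comm\<close> speaks about, whence all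
    idempotents commute.\<close>
  have idem: "\<exists>b. P e b \<and> e = e \<otimes> b" if e: "e \<in> carrier S" "e \<otimes> e = e" for e
  proof -
    obtain f where f: "P e f" using ex e by blast
    note fc = clos[OF f] note sf = sym[OF f] note ref = reg[OF f] note rff = reg[OF sf]
    have ee: "e \<otimes> (e \<otimes> y) = e \<otimes> y" if "y \<in> carrier S" for y
      using e that by (simp flip: m_assoc)
    have "f = (f \<otimes> e) \<otimes> (e \<otimes> f)" using rff fc ee by (simp add: m_assoc)
    also have "\<dots> = (e \<otimes> f) \<otimes> (f \<otimes> e)" by (rule comm[OF sf f])
    finally have f2: "f = (e \<otimes> f) \<otimes> (f \<otimes> e)" .
    have "e \<otimes> f = e \<otimes> ((e \<otimes> f) \<otimes> (f \<otimes> e))" using f2 by simp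
    also have "\<dots> = (e \<otimes> f) \<otimes> (f \<otimes> e)" using fc ee by (simp add: m_assoc)
    finally have 1: "e \<otimes> f = f" using f2 by simp
    have "f \<otimes> e = ((e \<otimes> f) \<otimes> (f \<otimes> e)) \<otimes> e" using f2 by simp
    also have "\<dots> = (e \<otimes> f) \<otimes> (f \<otimes> e)" using fc e by (simp add: m_assoc)
    finally have 2: "f \<otimes> e = f" using f2 by simp
    have "e = f" using ref 1 2 by simp
    then show ?thesis using f e by auto
  qed
  have idc: "e \<otimes> f = f \<otimes> e"
    if "e \<in> carrier S" "e \<otimes> e = e" "f \<in> carrier S" "f \<otimes> f = f" for e f
    using idem[of e] idem[of f] that comm by metis
  show ?thesis
  proof unfold_locales
    fix a assume a: "a \<in> carrier S"
    obtain b where b: "P a b" using ex a by blast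
    have ib: "is_sinv S a b"
      using clos[OF b] reg[OF b] reg[OF sym[OF b]] by (simp add: is_sinv_def)
    \<comment> \<open>Two inverses \<open>b\<close> and \<open>c\<close> of \<open>a\<close> give
      idempotents that absorb each other; as these commute,
      \<open>a \<otimes> b = a \<otimes> c\<close> and \<open>b \<otimes> a = c \<otimes> a\<close>,
      so \<open>c = c \<otimes> a \<otimes> c = b \<otimes> a \<otimes> b = b\<close>.\<close>
    have "c = b" if c: "is_sinv S a c" for c
    proof -
      from c ib have c: "c \<in> carrier S" "a \<otimes> c \<otimes> a = a" "c \<otimes> a \<otimes> c = c"
        and b: "b \<in> carrier S" "a \<otimes> b \<otimes> a = a" "b \<otimes> a \<otimes> b = b" by (auto simp: is_sinv_def)
      have idem: "(x \<otimes> y) \<otimes> (x \<otimes> y) = x \<otimes> y"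
        if "x \<otimes> y \<otimes> x = x" "x \<in> carrier S" "y \<in> carrier S" for x y
        using that by (simp flip: m_assoc)
      have "a \<otimes> b = (a \<otimes> c) \<otimes> (a \<otimes> b)" using a b c by (simp flip: m_assoc)
      also have "\<dots> = (a \<otimes> b) \<otimes> (a \<otimes> c)" by (rule idc) (use a b c idem in auto)
      also have "\<dots> = a \<otimes> c" using a b c by (simp flip: m_assoc)
      finally have ab: "a \<otimes> b = a \<otimes> c" .
      have "b \<otimes> a = (b \<otimes> a) \<otimes> (c \<otimes> a)" using a b c by (simp add: m_assoc)
      also have "\<dots> = (c \<otimes> a) \<otimes> (b \<otimes> a)" by (rule idc) (use a b c idem in auto)
      also have "\<dots> = c \<otimes> a" using a b c by (simp add: m_assoc)
      finally have ba: "b \<otimes> a = c \<otimes> a" .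
      have "c = c \<otimes> a \<otimes> c" using c by simp
      also have "\<dots> = b \<otimes> a \<otimes> c" using ba by simp
      also have "\<dots> = b \<otimes> (a \<otimes> b)" using a b c ab by (simp add: m_assoc)
      also have "\<dots> = b" using a b by (simp flip: m_assoc)
      finally show ?thesis .
    qed
    then show "\<exists>!b. is_sinv S a b" using ib by blast
  qed
qed

section \<open>Calculus of inverses and idempotents\<close>

context inverse_monoid
begin

abbreviation star (\<open>_\<^sup>\<star>\<close> [1000] 1000) where "a\<^sup>\<star> \<equiv> sinv S a"

lemma is_sinv_sinv: "a \<in> carrier S \<Longrightarrow> is_sinv S a (a\<^sup>\<star>)"
  unfolding sinv_def by (rule theI'[OF ex1_sinv])

lemma sinv_closed [simp]: "a \<in> carrier S \<Longrightarrow> a\<^sup>\<star> \<in> carrier S"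
  using is_sinv_sinv by (simp add: is_sinv_def)

lemma sinv_regular: "a \<in> carrier S \<Longrightarrow> a \<otimes> a\<^sup>\<star> \<otimes> a = a" "a \<in> carrier S \<Longrightarrow> a\<^sup>\<star> \<otimes> a \<otimes> a\<^sup>\<star> = a\<^sup>\<star>"
  using is_sinv_sinv by (simp_all add: is_sinv_def)

lemma sinv_eqI: "\<lbrakk>a \<in> carrier S; b \<in> carrier S; a \<otimes> b \<otimes> a = a; b \<otimes> a \<otimes> b = b\<rbrakk> \<Longrightarrow> a\<^sup>\<star> = b"
  using ex1_sinv[of a] is_sinv_sinv[of a] is_sinv_def[of S a b] by blast

lemma sinv_sinv [simp]: "a \<in> carrier S \<Longrightarrow> a\<^sup>\<star>\<^sup>\<star> = a"
  by (rule sinv_eqI) (simp_all add: sinv_regular)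

lemma sinv_idempotent: "e \<in> idempotents S \<Longrightarrow> e\<^sup>\<star> = e"
  by (rule sinv_eqI) (simp_all add: idempotents_iff)

lemma mult_sinv_idempotent: "a \<in> carrier S \<Longrightarrow> a \<otimes> a\<^sup>\<star> \<in> idempotents S"
  using sinv_regular(1)[of a] by (simp add: idempotents_iff flip: m_assoc)

lemma sinv_mult_idempotent: "a \<in> carrier S \<Longrightarrow> a\<^sup>\<star> \<otimes> a \<in> idempotents S"
  using mult_sinv_idempotent[of "a\<^sup>\<star>"] by simp

text \<open>If \<open>x\<close> is the inverse of \<open>e \<otimes> f\<close>, then
  \<open>f \<otimes> x \<otimes> e\<close> is an inverse too, so it equals \<open>x\<close>; it is
  idempotent because \<open>x \<otimes> (e \<otimes> f) \<otimes> x = x\<close>. An idempotent is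
  its own inverse, hence \<open>e \<otimes> f\<close>, being the inverse of \<open>x\<close>, equals
  \<open>x\<close>.\<close>

lemma idempotents_mult:
  assumes "e \<in> idempotents S" "f \<in> idempotents S"
  shows "e \<otimes> f \<in> idempotents S"
proof -
  have e: "e \<in> carrier S" "e \<otimes> e = e" and f: "f \<in> carrier S" "f \<otimes> f = f"
    using assms by (auto simp: idempotents_iff)
  define x where "x = (e \<otimes> f)\<^sup>\<star>"
  have x: "x \<in> carrier S" "(e \<otimes> f) \<otimes> x \<otimes> (e \<otimes> f) = e \<otimes> f" "x \<otimes> (e \<otimes> f) \<otimes> x = x"
    using e f sinv_regular[of "e \<otimes> f"] by (auto simp: x_def)
  \<comment> \<open>Products are normalised to the right, so each law is restated in that form, with
    a trailing factor \<open>y\<close> where it must apply inside a longer product.\<close>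
  have ee: "e \<otimes> (e \<otimes> y) = e \<otimes> y" if "y \<in> carrier S" for y
    using e that by (simp flip: m_assoc)
  have ff: "f \<otimes> (f \<otimes> y) = f \<otimes> y" if "y \<in> carrier S" for y
    using f that by (simp flip: m_assoc)
  have x': "e \<otimes> (f \<otimes> (x \<otimes> (e \<otimes> f))) = e \<otimes> f" "x \<otimes> (e \<otimes> (f \<otimes> x)) = x"
    using x e f by (simp_all add: m_assoc)
  have x'': "x \<otimes> (e \<otimes> (f \<otimes> (x \<otimes> y))) = x \<otimes> y" if "y \<in> carrier S" for y
    using x(3) e f x(1) that by (simp flip: m_assoc)
  have "x = f \<otimes> x \<otimes> e"
    unfolding x_def
    by (rule sinv_eqI) (use e f x x' x'' ee ff in \<open>simp_all add: m_assoc flip: x_def\<close>)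
  moreover have "(f \<otimes> x \<otimes> e) \<otimes> (f \<otimes> x \<otimes> e) = f \<otimes> x \<otimes> e"
    using e f x x'' by (simp add: m_assoc)
  ultimately have xi: "x \<in> idempotents S" using x by (simp add: idempotents_iff)
  have "e \<otimes> f = x\<^sup>\<star>" using e f by (simp add: x_def)
  then show ?thesis using sinv_idempotent[OF xi] xi by simp
qed

text \<open>Both products are idempotent, so \<open>f \<otimes> e\<close> is an inverse of
  \<open>e \<otimes> f\<close>; so is \<open>e \<otimes> f\<close> itself, and inverses are
  unique.\<close>

lemma idempotents_commute:
  assumes "e \<in> idempotents S" "f \<in> idempotents S"
  shows "e \<otimes> f = f \<otimes> e"
proof -
  have e: "e \<in> carrier S" "e \<otimes> e = e" and f: "f \<in> carrier S" "f \<otimes> f = f"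
    using assms by (auto simp: idempotents_iff)
  have ef: "(e \<otimes> f) \<otimes> (e \<otimes> f) = e \<otimes> f" "(f \<otimes> e) \<otimes> (f \<otimes> e) = f \<otimes> e"
    using idempotents_mult assms by (auto simp: idempotents_iff)
  have ee: "e \<otimes> (e \<otimes> y) = e \<otimes> y" "f \<otimes> (f \<otimes> y) = f \<otimes> y" if "y \<in> carrier S" for y
    using e f that by (simp_all flip: m_assoc)
  have "(e \<otimes> f)\<^sup>\<star> = f \<otimes> e"
    by (rule sinv_eqI) (use e f ef ee in \<open>simp_all add: m_assoc\<close>)
  then show ?thesis using sinv_idempotent idempotents_mult assms by metis
qed

text \<open>Commuting the inner idempotents \<open>b \<otimes> b\<^sup>\<star>\<close> and
  \<open>a\<^sup>\<star> \<otimes> a\<close> regroups each triple product into regularity for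
  \<open>a\<close> times regularity for \<open>b\<close>.\<close>

lemma sinv_mult:
  assumes a: "a \<in> carrier S" and b: "b \<in> carrier S"
  shows "(a \<otimes> b)\<^sup>\<star> = b\<^sup>\<star> \<otimes> a\<^sup>\<star>"
proof -
  have c: "(b \<otimes> b\<^sup>\<star>) \<otimes> (a\<^sup>\<star> \<otimes> a) = (a\<^sup>\<star> \<otimes> a) \<otimes> (b \<otimes> b\<^sup>\<star>)"
    by (rule idempotents_commute) (use a b in \<open>auto intro: mult_sinv_idempotent sinv_mult_idempotent\<close>)
  have "a \<otimes> b \<otimes> (b\<^sup>\<star> \<otimes> a\<^sup>\<star>) \<otimes> (a \<otimes> b) = a \<otimes> ((b \<otimes> b\<^sup>\<star>) \<otimes> (a\<^sup>\<star> \<otimes> a)) \<otimes> b"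
    using a b by (simp add: m_assoc)
  also have "\<dots> = (a \<otimes> a\<^sup>\<star> \<otimes> a) \<otimes> (b \<otimes> b\<^sup>\<star> \<otimes> b)"
    unfolding c using a b by (simp add: m_assoc)
  finally have 1: "a \<otimes> b \<otimes> (b\<^sup>\<star> \<otimes> a\<^sup>\<star>) \<otimes> (a \<otimes> b) = a \<otimes> b"
    using a b by (simp add: sinv_regular)
  have "b\<^sup>\<star> \<otimes> a\<^sup>\<star> \<otimes> (a \<otimes> b) \<otimes> (b\<^sup>\<star> \<otimes> a\<^sup>\<star>) = b\<^sup>\<star> \<otimes> ((a\<^sup>\<star> \<otimes> a) \<otimes> (b \<otimes> b\<^sup>\<star>)) \<otimes> a\<^sup>\<star>"
    using a b by (simp add: m_assoc)
  also have "\<dots> = (b\<^sup>\<star> \<otimes> b \<otimes> b\<^sup>\<star>) \<otimes> (a\<^sup>\<star> \<otimes> a \<otimes> a\<^sup>\<star>)"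
    unfolding c[symmetric] using a b by (simp add: m_assoc)
  finally have 2: "b\<^sup>\<star> \<otimes> a\<^sup>\<star> \<otimes> (a \<otimes> b) \<otimes> (b\<^sup>\<star> \<otimes> a\<^sup>\<star>) = b\<^sup>\<star> \<otimes> a\<^sup>\<star>"
    using a b by (simp add: sinv_regular)
  show ?thesis by (rule sinv_eqI) (use a b 1 2 in auto)
qed

lemma conj_idempotent:
  assumes "e \<in> idempotents S" "a \<in> carrier S"
  shows "a \<otimes> e \<otimes> a\<^sup>\<star> \<in> idempotents S"
proof -
  have e: "e \<in> carrier S" "e \<otimes> e = e" using assms by (auto simp: idempotents_iff)
  have "(a \<otimes> e) \<otimes> (a \<otimes> e)\<^sup>\<star> = a \<otimes> e \<otimes> a\<^sup>\<star>"
    using assms e by (simp add: sinv_mult sinv_idempotent flip: m_assoc) (simp add: m_assoc e)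
  then show ?thesis using mult_sinv_idempotent[of "a \<otimes> e"] assms e by simp
qed

text \<open>An idempotent passes from the right of \<open>a\<close> to its left at the price of
  conjugation, because it commutes with \<open>a\<^sup>\<star> \<otimes> a\<close>. This makes the
  one-sided definition of the natural order two-sided.\<close>

lemma mult_idempotent_swap:
  assumes "e \<in> idempotents S" "a \<in> carrier S"
  shows "a \<otimes> e = (a \<otimes> e \<otimes> a\<^sup>\<star>) \<otimes> a"
proof -
  have e: "e \<in> carrier S" using assms by (auto simp: idempotents_iff)
  have "(a \<otimes> e \<otimes> a\<^sup>\<star>) \<otimes> a = a \<otimes> (e \<otimes> (a\<^sup>\<star> \<otimes> a))" using assms e by (simp add: m_assoc)
  also have "\<dots> = a \<otimes> ((a\<^sup>\<star> \<otimes> a) \<otimes> e)"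
    by (simp only: idempotents_commute[OF assms(1) sinv_mult_idempotent[OF assms(2)]])
  also have "\<dots> = (a \<otimes> a\<^sup>\<star> \<otimes> a) \<otimes> e" using assms e by (simp add: m_assoc)
  also have "\<dots> = a \<otimes> e" using assms by (simp add: sinv_regular)
  finally show ?thesis by simp
qed

section \<open>The natural partial order and its compatibility with the operations\<close>

lemma nat_le_mult_left: "e \<in> idempotents S \<Longrightarrow> a \<in> carrier S \<Longrightarrow> nat_le S (e \<otimes> a) a"
  by (auto simp: nat_le_def idempotents_iff)

lemma nat_le_mult_right:
  assumes "e \<in> idempotents S" "a \<in> carrier S"
  shows "nat_le S (a \<otimes> e) a"
  using nat_le_mult_left[OF conj_idempotent[OF assms] assms(2)]
  by (simp only: mult_idempotent_swap[OF assms, symmetric])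

text \<open>Deleting an idempotent anywhere in a product moves up in the order. Compatibility with
  multiplication and the transitivity of \<open>a \<otimes> b\<^sup>\<star> \<in> C\<close> both
  rest on this.\<close>

lemma nat_le_mult_middle:
  assumes "e \<in> idempotents S" "a \<in> carrier S" "b \<in> carrier S"
  shows "nat_le S (a \<otimes> e \<otimes> b) (a \<otimes> b)"
proof -
  have e: "e \<in> carrier S" using assms by (auto simp: idempotents_iff)
  have "a \<otimes> e \<otimes> b = (a \<otimes> e \<otimes> a\<^sup>\<star>) \<otimes> a \<otimes> b"
    by (simp only: mult_idempotent_swap[OF assms(1,2), symmetric])
  also have "\<dots> = (a \<otimes> e \<otimes> a\<^sup>\<star>) \<otimes> (a \<otimes> b)" using assms e by (simp add: m_assoc)
  finally have "a \<otimes> e \<otimes> b = (a \<otimes> e \<otimes> a\<^sup>\<star>) \<otimes> (a \<otimes> b)" .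
  then show ?thesis using nat_le_mult_left[of "a \<otimes> e \<otimes> a\<^sup>\<star>" "a \<otimes> b"] conj_idempotent assms by simp
qed

lemma nat_le_refl: "a \<in> carrier S \<Longrightarrow> nat_le S a a"
  using nat_le_mult_left[of \<one> a] by (simp add: idempotents_iff)

lemma nat_le_trans:
  assumes "nat_le S a b" "nat_le S b c"
  shows "nat_le S a c"
proof -
  obtain e f where e: "e \<in> idempotents S" "a = e \<otimes> b" and f: "f \<in> idempotents S" "b = f \<otimes> c"
    and c: "a \<in> carrier S" "c \<in> carrier S"
    using assms by (auto simp: nat_le_def)
  have "a = (e \<otimes> f) \<otimes> c" using e f c by (auto simp: idempotents_iff m_assoc)
  then show ?thesis using nat_le_mult_left[OF idempotents_mult[OF e(1) f(1)] c(2)] by simp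
qed

lemma nat_le_mult:
  assumes "nat_le S a s" "nat_le S b t"
  shows "nat_le S (a \<otimes> b) (s \<otimes> t)"
proof -
  obtain e f where e: "e \<in> idempotents S" "a = e \<otimes> s" and f: "f \<in> idempotents S" "b = f \<otimes> t"
    and c: "s \<in> carrier S" "t \<in> carrier S"
    using assms by (auto simp: nat_le_def)
  have "a \<otimes> b = e \<otimes> (s \<otimes> f \<otimes> t)" using e f c by (auto simp: idempotents_iff m_assoc)
  moreover have "nat_le S (s \<otimes> f \<otimes> t) (s \<otimes> t)" by (rule nat_le_mult_middle[OF f(1) c])
  moreover have "nat_le S (e \<otimes> (s \<otimes> f \<otimes> t)) (s \<otimes> f \<otimes> t)"
    by (rule nat_le_mult_left) (use e f c in \<open>auto simp: idempotents_iff\<close>)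
  ultimately show ?thesis using nat_le_trans by metis
qed

lemma nat_le_sinv:
  assumes "nat_le S a s"
  shows "nat_le S (a\<^sup>\<star>) (s\<^sup>\<star>)"
proof -
  obtain e where e: "e \<in> idempotents S" "a = e \<otimes> s" and s: "s \<in> carrier S"
    using assms by (auto simp: nat_le_def)
  have "a\<^sup>\<star> = s\<^sup>\<star> \<otimes> e" using e s by (simp add: sinv_mult sinv_idempotent idempotents_iff)
  then show ?thesis using nat_le_mult_right[OF e(1)] s by simp
qed

section \<open>Normal inverse subsemigroups\<close>

text \<open>The idempotents of a subsemigroup \<open>N\<close> are those of \<open>S\<close> that
  lie in \<open>N\<close>, so the equality in the definition amounts to an inclusion.\<close>

lemma normal_inverse_subsemigroup_iff:
  "normal_inverse_subsemigroup S N \<longleftrightarrow> inverse_subsemigroup S N \<and> idempotents S \<subseteq> N \<and>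
     (\<forall>s \<in> carrier S. \<forall>n \<in> N. s\<^sup>\<star> \<otimes> n \<otimes> s \<in> N)"
  by (auto simp: normal_inverse_subsemigroup_def inverse_subsemigroup_def idempotents_def)

lemma normal_inverse_submonoid:
  assumes "normal_inverse_subsemigroup S N"
  shows "inverse_submonoid S N"
  using assms
  by (auto simp: normal_inverse_subsemigroup_iff inverse_submonoid_def inverse_subsemigroup_def
      idempotents_iff intro!: submonoid.intro)

text \<open>All the conditions pass to intersections. The whole carrier is a member of the family,
  which keeps the intersection inside \<open>carrier S\<close>.\<close>

lemma normal_inverse_hull_normal:
  assumes "A \<subseteq> carrier S"
  shows "normal_inverse_subsemigroup S (normal_inverse_hull S A)"
proof -
  have "normal_inverse_subsemigroup S (carrier S)"
    by (auto simp: normal_inverse_subsemigroup_iff inverse_subsemigroup_def idempotents_iff)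
  then have "normal_inverse_hull S A \<subseteq> carrier S"
    using assms by (auto simp: normal_inverse_hull_def)
  then show ?thesis
    unfolding normal_inverse_subsemigroup_iff inverse_subsemigroup_def
    by (auto simp: normal_inverse_hull_def normal_inverse_subsemigroup_iff inverse_subsemigroup_def)
qed

section \<open>Upward closures\<close>

lemma upward_closure_eq:
  assumes "A \<subseteq> carrier S"
  shows "upward_closure S A = {s. \<exists>a \<in> A. nat_le S a s}" (is "_ = ?B")
proof
  have "?B \<subseteq> carrier S" by (auto simp: nat_le_def)
  then have "upward_closed S ?B"
    unfolding upward_closed_def using nat_le_trans by blast
  moreover have "A \<subseteq> ?B" using assms nat_le_refl by blast
  ultimately show "upward_closure S A \<subseteq> ?B" unfolding upward_closure_def by blast
  show "?B \<subseteq> upward_closure S A"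
  proof
    fix s assume "s \<in> ?B"
    then obtain a where a: "a \<in> A" "nat_le S a s" by blast
    then have "s \<in> carrier S" by (simp add: nat_le_def)
    then show "s \<in> upward_closure S A" using a by (auto simp: upward_closure_def upward_closed_def)
  qed
qed

lemma upward_closure_closed:
  assumes "A \<subseteq> carrier S"
  shows "upward_closed S (upward_closure S A)"
proof -
  have "{s. \<exists>a \<in> A. nat_le S a s} \<subseteq> carrier S" by (auto simp: nat_le_def)
  then show ?thesis
    unfolding upward_closure_eq[OF assms] upward_closed_def using nat_le_trans by blast
qed

text \<open>The order respects products, inverses and conjugation, so applying the operation to
  elements of \<open>N\<close> below the arguments gives an element of \<open>N\<close> below the
  result.\<close>

lemma upward_closure_normal:
  assumes N: "normal_inverse_subsemigroup S N"
  shows "normal_inverse_subsemigroup S (upward_closure S N)"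
proof -
  have sub: "N \<subseteq> carrier S" and m: "\<And>a b. a \<in> N \<Longrightarrow> b \<in> N \<Longrightarrow> a \<otimes> b \<in> N"
    and i: "\<And>a. a \<in> N \<Longrightarrow> a\<^sup>\<star> \<in> N" and E: "idempotents S \<subseteq> N"
    and c: "\<And>s n. s \<in> carrier S \<Longrightarrow> n \<in> N \<Longrightarrow> s\<^sup>\<star> \<otimes> n \<otimes> s \<in> N"
    using N by (auto simp: normal_inverse_subsemigroup_iff inverse_subsemigroup_def)
  show ?thesis
    unfolding normal_inverse_subsemigroup_iff inverse_subsemigroup_def upward_closure_eq[OF sub]
  proof (intro conjI ballI)
    show "{s. \<exists>a\<in>N. nat_le S a s} \<subseteq> carrier S" by (auto simp: nat_le_def)
    show "idempotents S \<subseteq> {s. \<exists>a\<in>N. nat_le S a s}"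
      using E sub nat_le_refl by blast
  next
    fix x y assume "x \<in> {s. \<exists>a\<in>N. nat_le S a s}" "y \<in> {s. \<exists>a\<in>N. nat_le S a s}"
    then show "x \<otimes> y \<in> {s. \<exists>a\<in>N. nat_le S a s}" using m nat_le_mult by blast
  next
    fix x assume "x \<in> {s. \<exists>a\<in>N. nat_le S a s}"
    then show "x\<^sup>\<star> \<in> {s. \<exists>a\<in>N. nat_le S a s}" using i nat_le_sinv by blast
  next
    fix s x assume s: "s \<in> carrier S" and "x \<in> {s. \<exists>a\<in>N. nat_le S a s}"
    then obtain n where "n \<in> N" "nat_le S n x" by blast
    then have "nat_le S (s\<^sup>\<star> \<otimes> n \<otimes> s) (s\<^sup>\<star> \<otimes> x \<otimes> s)"
      by (intro nat_le_mult nat_le_refl sinv_closed s)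
    then show "s\<^sup>\<star> \<otimes> x \<otimes> s \<in> {s. \<exists>a\<in>N. nat_le S a s}"
      using c[OF s \<open>n \<in> N\<close>] by blast
  qed
qed

section \<open>Congruences\<close>

text \<open>Idempotents in \<open>C\<close> give reflexivity, inverses give symmetry, and
  conjugation gives compatibility on the left. Closedness enters in transitivity, where the inner
  \<open>b\<^sup>\<star> \<otimes> b\<close> has to be deleted.\<close>

lemma closed_normal_congruence:
  assumes C: "normal_inverse_subsemigroup S C" and cl: "upward_closed S C"
  shows "congruence S {(a, b). a \<in> carrier S \<and> b \<in> carrier S \<and> a \<otimes> b\<^sup>\<star> \<in> C}"
    (is "congruence S ?\<tau>")
proof -
  have sub: "C \<subseteq> carrier S" and m: "\<And>a b. a \<in> C \<Longrightarrow> b \<in> C \<Longrightarrow> a \<otimes> b \<in> C"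
    and i: "\<And>a. a \<in> C \<Longrightarrow> a\<^sup>\<star> \<in> C" and E: "idempotents S \<subseteq> C"
    and c: "\<And>s n. s \<in> carrier S \<Longrightarrow> n \<in> C \<Longrightarrow> s\<^sup>\<star> \<otimes> n \<otimes> s \<in> C"
    using C by (auto simp: normal_inverse_subsemigroup_iff inverse_subsemigroup_def)
  have up: "s \<in> C" if "a \<in> C" "nat_le S a s" for a s
    using cl that by (auto simp: upward_closed_def nat_le_def)
  have "equiv (carrier S) ?\<tau>"
  proof (rule equivI)
    show "?\<tau> \<subseteq> carrier S \<times> carrier S" by auto
    show "refl_on (carrier S) ?\<tau>" using E mult_sinv_idempotent by (auto simp: refl_on_def)
    show "sym ?\<tau>"
    proof (rule symI)
      fix a b assume "(a, b) \<in> ?\<tau>"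
      then show "(b, a) \<in> ?\<tau>" using i[of "a \<otimes> b\<^sup>\<star>"] by (auto simp: sinv_mult)
    qed
    show "trans ?\<tau>"
    proof (rule transI)
      fix a b d assume "(a, b) \<in> ?\<tau>" "(b, d) \<in> ?\<tau>"
      then have ab: "a \<in> carrier S" "b \<in> carrier S" "d \<in> carrier S" "a \<otimes> b\<^sup>\<star> \<in> C" "b \<otimes> d\<^sup>\<star> \<in> C"
        by auto
      have "nat_le S (a \<otimes> (b\<^sup>\<star> \<otimes> b) \<otimes> d\<^sup>\<star>) (a \<otimes> d\<^sup>\<star>)"
        by (rule nat_le_mult_middle) (use ab sinv_mult_idempotent in auto)
      moreover have "a \<otimes> (b\<^sup>\<star> \<otimes> b) \<otimes> d\<^sup>\<star> = (a \<otimes> b\<^sup>\<star>) \<otimes> (b \<otimes> d\<^sup>\<star>)" using ab by (simp add: m_assoc)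
      ultimately show "(a, d) \<in> ?\<tau>" using up m ab by auto
    qed
  qed
  moreover have "(d \<otimes> a, d \<otimes> b) \<in> ?\<tau> \<and> (a \<otimes> d, b \<otimes> d) \<in> ?\<tau>"
    if "(a, b) \<in> ?\<tau>" and d: "d \<in> carrier S" for a b d
  proof -
    have ab: "a \<in> carrier S" "b \<in> carrier S" "a \<otimes> b\<^sup>\<star> \<in> C" using that by auto
    \<comment> \<open>The double star matches the shape
      \<open>s\<^sup>\<star> \<otimes> n \<otimes> s\<close> of conjugation, taken at
      \<open>s = d\<^sup>\<star>\<close>.\<close>
    have "(d \<otimes> a) \<otimes> (d \<otimes> b)\<^sup>\<star> = d\<^sup>\<star>\<^sup>\<star> \<otimes> (a \<otimes> b\<^sup>\<star>) \<otimes> d\<^sup>\<star>"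
      using ab d by (simp add: sinv_mult m_assoc)
    then have 1: "(d \<otimes> a) \<otimes> (d \<otimes> b)\<^sup>\<star> \<in> C" using c[of "d\<^sup>\<star>", OF _ ab(3)] d by simp
    \<comment> \<open>Moving \<open>d \<otimes> d\<^sup>\<star>\<close> to the left of
      \<open>a\<close> leaves an idempotent times \<open>a \<otimes> b\<^sup>\<star>\<close>, both
      in \<open>C\<close>.\<close>
    have "(a \<otimes> d) \<otimes> (b \<otimes> d)\<^sup>\<star> = (a \<otimes> (d \<otimes> d\<^sup>\<star>)) \<otimes> b\<^sup>\<star>"
      using ab d by (simp add: sinv_mult m_assoc)
    also have "\<dots> = (a \<otimes> (d \<otimes> d\<^sup>\<star>) \<otimes> a\<^sup>\<star>) \<otimes> a \<otimes> b\<^sup>\<star>"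
      by (simp only: mult_idempotent_swap[OF mult_sinv_idempotent[OF d] ab(1), symmetric])
    also have "\<dots> = (a \<otimes> (d \<otimes> d\<^sup>\<star>) \<otimes> a\<^sup>\<star>) \<otimes> (a \<otimes> b\<^sup>\<star>)"
      using ab d by (simp add: m_assoc)
    also have "\<dots> \<in> C"
      using m E conj_idempotent[OF mult_sinv_idempotent[OF d] ab(1)] ab(3) by blast
    finally show ?thesis using 1 ab d by simp
  qed
  ultimately show ?thesis unfolding congruence_def by blast
qed

lemma kernel_subset_closed_normal:
  assumes C: "normal_inverse_subsemigroup S C" and cl: "upward_closed S C"
    and R: "R \<subseteq> carrier S \<times> carrier S" "\<And>l r. (l, r) \<in> R \<Longrightarrow> l \<otimes> r\<^sup>\<star> \<in> C"
  shows "congruence_kernel S (generated_congruence S R) \<subseteq> C"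
proof
  fix s assume "s \<in> congruence_kernel S (generated_congruence S R)"
  then obtain e where e: "e \<in> idempotents S" "(s, e) \<in> generated_congruence S R"
    and s: "s \<in> carrier S" by (auto simp: congruence_kernel_def)
  have "R \<subseteq> {(a, b). a \<in> carrier S \<and> b \<in> carrier S \<and> a \<otimes> b\<^sup>\<star> \<in> C}" using R by auto
  then have "s \<otimes> e\<^sup>\<star> \<in> C"
    using e closed_normal_congruence[OF C cl] by (auto simp: generated_congruence_def)
  then have "s \<otimes> e \<in> C" using e sinv_idempotent by simp
  then show "s \<in> C" using nat_le_mult_right[OF e(1) s] cl s by (auto simp: upward_closed_def)
qed

section \<open>Homomorphisms between inverse monoids and their kernels\<close>

lemma hom_idempotent: "h \<in> hom S M \<Longrightarrow> e \<in> idempotents S \<Longrightarrow> h e \<in> idempotents M"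
  by (auto simp: idempotents_iff hom_def) (metis PiE)

text \<open>Membership in \<open>hom\<close> speaks of products only; uniqueness of inverses in
  \<open>M\<close> carries it over to inverses.\<close>

lemma hom_sinv:
  assumes M: "inverse_monoid M" and h: "h \<in> hom S M" and a: "a \<in> carrier S"
  shows "h (a\<^sup>\<star>) = sinv M (h a)"
proof (rule inverse_monoid.sinv_eqI[OF M, symmetric])
  have hm: "h x \<otimes>\<^bsub>M\<^esub> h y = h (x \<otimes> y)" if "x \<in> carrier S" "y \<in> carrier S" for x y
    using h that by (simp add: hom_mult)
  show "h a \<in> carrier M" "h (a\<^sup>\<star>) \<in> carrier M" using h a by (auto intro: hom_in_carrier)
  show "h a \<otimes>\<^bsub>M\<^esub> h (a\<^sup>\<star>) \<otimes>\<^bsub>M\<^esub> h a = h a" "h (a\<^sup>\<star>) \<otimes>\<^bsub>M\<^esub> h a \<otimes>\<^bsub>M\<^esub> h (a\<^sup>\<star>) = h (a\<^sup>\<star>)"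
    using a by (simp_all add: hm sinv_regular)
qed

text \<open>Idempotents lift along \<open>h\<close> (Lallement's lemma for inverse monoids): an
  idempotent \<open>h a\<close> is its own inverse, so the idempotent
  \<open>a\<^sup>\<star> \<otimes> a\<close> has the same image as \<open>a\<close>.\<close>

lemma hom_idempotent_lift:
  assumes M: "inverse_monoid M" and h: "h \<in> hom S M" and a: "a \<in> carrier S"
    and i: "h a \<in> idempotents M"
  shows "h (a\<^sup>\<star> \<otimes> a) = h a"
  using inverse_monoid.sinv_idempotent[OF M i] i a h hom_sinv[OF M h a]
  by (simp add: hom_mult idempotents_iff)

text \<open>Turns the kernel into a preimage of idempotents, with which all later arguments work.
  Lifting of idempotents supplies the element of \<open>idempotents S\<close> related to
  \<open>s\<close>.\<close>

lemma congruence_kernel_eq: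
  assumes M: "inverse_monoid M" and h: "h \<in> hom S M"
    and \<rho>: "\<And>a b. a \<in> carrier S \<Longrightarrow> b \<in> carrier S \<Longrightarrow> (a, b) \<in> \<rho> \<longleftrightarrow> h a = h b"
  shows "congruence_kernel S \<rho> = {s \<in> carrier S. h s \<in> idempotents M}"
proof -
  have "(\<exists>e \<in> idempotents S. (s, e) \<in> \<rho>) \<longleftrightarrow> h s \<in> idempotents M" if s: "s \<in> carrier S" for s
  proof
    assume "\<exists>e \<in> idempotents S. (s, e) \<in> \<rho>"
    then obtain e where e: "e \<in> idempotents S" "(s, e) \<in> \<rho>" by blast
    then have "h s = h e" using \<rho> s by (auto simp: idempotents_iff)
    then show "h s \<in> idempotents M" using hom_idempotent h e by metis
  next
    assume "h s \<in> idempotents M"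
    then have "(s, s\<^sup>\<star> \<otimes> s) \<in> \<rho>" using hom_idempotent_lift[OF M h s] \<rho> s by simp
    then show "\<exists>e \<in> idempotents S. (s, e) \<in> \<rho>" using sinv_mult_idempotent s by blast
  qed
  then show ?thesis by (auto simp: congruence_kernel_def)
qed

lemma kernel_normal:
  assumes M: "inverse_monoid M" and h: "h \<in> hom S M"
  shows "normal_inverse_subsemigroup S {s \<in> carrier S. h s \<in> idempotents M}"
proof -
  interpret M: inverse_monoid M by fact
  have "h (s\<^sup>\<star> \<otimes> n \<otimes> s) \<in> idempotents M"
    if s: "s \<in> carrier S" and n: "n \<in> carrier S" "h n \<in> idempotents M" for s n
  proof -
    have hs: "h s \<in> carrier M" using h s by (rule hom_in_carrier)
    have "sinv M (h s) \<otimes>\<^bsub>M\<^esub> h n \<otimes>\<^bsub>M\<^esub> h s \<in> idempotents M"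
      using M.conj_idempotent[OF n(2), of "sinv M (h s)"] hs by simp
    then show ?thesis using s n h by (simp add: hom_mult hom_sinv[OF M h])
  qed
  moreover have "h (a\<^sup>\<star>) \<in> idempotents M" if "a \<in> carrier S" "h a \<in> idempotents M" for a
    using that by (simp add: hom_sinv[OF M h] M.sinv_idempotent)
  moreover have "h (a \<otimes> b) \<in> idempotents M"
    if "a \<in> carrier S" "h a \<in> idempotents M" "b \<in> carrier S" "h b \<in> idempotents M" for a b
    using that M.idempotents_mult by (simp add: hom_mult[OF h])
  moreover have "idempotents S \<subseteq> {s \<in> carrier S. h s \<in> idempotents M}"
    using hom_idempotent[OF h] by (auto simp: idempotents_iff[of _ S])
  ultimately show ?thesis
    unfolding normal_inverse_subsemigroup_iff inverse_subsemigroup_def by simp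
qed

lemma E_unitary_iff_kernel_closed:
  assumes M: "inverse_monoid M" and h: "h \<in> hom S M" and surj: "h ` carrier S = carrier M"
  shows "E_unitary M \<longleftrightarrow> upward_closed S {s \<in> carrier S. h s \<in> idempotents M}"
proof
  assume E: "E_unitary M"
  have "h s \<in> idempotents M" if "h a \<in> idempotents M" "nat_le S a s" for a s
  proof -
    obtain e where e: "e \<in> idempotents S" "a = e \<otimes> s" and s: "s \<in> carrier S"
      using \<open>nat_le S a s\<close> by (auto simp: nat_le_def)
    have "h a = h e \<otimes>\<^bsub>M\<^esub> h s" using e s h by (simp add: hom_mult idempotents_iff)
    then have "nat_le M (h a) (h s)"
      using inverse_monoid.nat_le_mult_left[OF M hom_idempotent[OF h e(1)]] hom_in_carrier[OF h s]
      by simp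
    then show ?thesis using E \<open>h a \<in> idempotents M\<close> hom_in_carrier[OF h s]
      unfolding E_unitary_def by blast
  qed
  then show "upward_closed S {s \<in> carrier S. h s \<in> idempotents M}"
    by (auto simp: upward_closed_def)
next
  assume cl: "upward_closed S {s \<in> carrier S. h s \<in> idempotents M}"
  have "m \<in> idempotents M" if e: "e \<in> idempotents M" and m: "m \<in> carrier M" and le: "nat_le M e m"
    for e m
  proof -
    obtain f where f: "f \<in> idempotents M" "e = f \<otimes>\<^bsub>M\<^esub> m" using le by (auto simp: nat_le_def)
    have "m \<in> h ` carrier S" "f \<in> h ` carrier S"
      using surj m f by (auto simp: idempotents_iff)
    then obtain a b where a: "a \<in> carrier S" "m = h a" and b: "b \<in> carrier S" "f = h b"
      by blast
    \<comment> \<open>The preimage \<open>b\<close> of \<open>f\<close> may fail to be idempotent;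
      \<open>b\<^sup>\<star> \<otimes> b\<close> is idempotent with the same image, so its product
      with \<open>a\<close> lies below \<open>a\<close> and maps to \<open>e\<close>.\<close>
    have i: "b\<^sup>\<star> \<otimes> b \<in> idempotents S" using b sinv_mult_idempotent by simp
    have "h (b\<^sup>\<star> \<otimes> b \<otimes> a) = h (b\<^sup>\<star> \<otimes> b) \<otimes>\<^bsub>M\<^esub> h a"
      using a b h by (simp only: hom_mult m_closed sinv_closed)
    also have "\<dots> = e" using hom_idempotent_lift[OF M h b(1)] f a b by simp
    finally have "b\<^sup>\<star> \<otimes> b \<otimes> a \<in> {s \<in> carrier S. h s \<in> idempotents M}" using e a b by simp
    moreover have "nat_le S (b\<^sup>\<star> \<otimes> b \<otimes> a) a" by (rule nat_le_mult_left[OF i a(1)])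
    ultimately show ?thesis using cl a by (auto simp: upward_closed_def)
  qed
  then show "E_unitary M" using M by (auto simp: E_unitary_def)
qed

end

section \<open>Generated congruences and quotient monoids\<close>

lemma generated_congruence_congruence:
  fixes S (structure)
  assumes S: "monoid S" and R: "R \<subseteq> carrier S \<times> carrier S"
  shows "congruence S (generated_congruence S R)"
proof -
  interpret monoid S by fact
  \<comment> \<open>The universal congruence contains \<open>R\<close>, so the intersection is a
    relation on the carrier; the other conditions pass to intersections.\<close>
  have "congruence S (carrier S \<times> carrier S)"
    by (auto simp: congruence_def intro!: equivI refl_onI symI transI)
  then have sub: "generated_congruence S R \<subseteq> carrier S \<times> carrier S"
    using R by (auto simp: generated_congruence_def)
  have genI: "p \<in> generated_congruence S R"
    if "\<And>\<rho>. congruence S \<rho> \<Longrightarrow> R \<subseteq> \<rho> \<Longrightarrow> p \<in> \<rho>" for p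
    using that by (simp add: generated_congruence_def)
  have genD: "p \<in> \<rho>" if "p \<in> generated_congruence S R" "congruence S \<rho>" "R \<subseteq> \<rho>" for p \<rho>
    using that by (simp add: generated_congruence_def)
  have eq: "equiv (carrier S) \<rho>" if "congruence S \<rho>" for \<rho>
    using that by (simp add: congruence_def)
  have "equiv (carrier S) (generated_congruence S R)"
  proof (rule equivI[OF sub])
    show "refl_on (carrier S) (generated_congruence S R)"
      by (intro refl_onI genI) (meson eq equivE refl_onD)
    show "sym (generated_congruence S R)"
      by (intro symI genI) (meson eq genD equivE symD)
    show "trans (generated_congruence S R)"
      by (intro transI genI) (meson eq genD equivE transD)
  qed
  moreover have "(c \<otimes> a, c \<otimes> b) \<in> generated_congruence S R \<and>
      (a \<otimes> c, b \<otimes> c) \<in> generated_congruence S R"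
    if ab: "(a, b) \<in> generated_congruence S R" and c: "c \<in> carrier S" for a b c
  proof -
    have "(c \<otimes> a, c \<otimes> b) \<in> \<rho> \<and> (a \<otimes> c, b \<otimes> c) \<in> \<rho>" if "congruence S \<rho>" "R \<subseteq> \<rho>" for \<rho>
      using genD[OF ab that] that(1) c unfolding congruence_def by fast
    then show ?thesis using genI by simp
  qed
  ultimately show ?thesis unfolding congruence_def by fast
qed

lemma subset_generated_congruence: "R \<subseteq> generated_congruence S R"
  by (auto simp: generated_congruence_def)

lemma quotient_monoid_mult:
  fixes S (structure)
  assumes c: "congruence S \<rho>" and S: "monoid S" and a: "a \<in> carrier S" and b: "b \<in> carrier S"
  shows "\<rho> `` {a} \<otimes>\<^bsub>quotient_monoid S \<rho>\<^esub> \<rho> `` {b} = \<rho> `` {a \<otimes> b}"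
proof -
  interpret monoid S by fact
  have eq: "equiv (carrier S) \<rho>" using c by (simp add: congruence_def)
  have "\<rho> `` {x \<otimes> y} = \<rho> `` {a \<otimes> b}" if "x \<in> \<rho> `` {a}" "y \<in> \<rho> `` {b}" for x y
  proof (rule equiv_class_eq[OF eq, symmetric])
    have xy: "(a, x) \<in> \<rho>" "(b, y) \<in> \<rho>" using that by auto
    then have "x \<in> carrier S" using eq by (auto simp: equiv_def)
    then have "(a \<otimes> b, x \<otimes> b) \<in> \<rho>" "(x \<otimes> b, x \<otimes> y) \<in> \<rho>"
      using c xy b unfolding congruence_def by blast+
    then show "(a \<otimes> b, x \<otimes> y) \<in> \<rho>" using eq by (meson equivE transD)
  qed
  \<comment> \<open>Both index sets are nonempty, so the union of the constant family is its common
    value.\<close>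
  moreover have "a \<in> \<rho> `` {a}" "b \<in> \<rho> `` {b}" using equiv_class_self[OF eq] a b by blast+
  ultimately have "(\<Union>x \<in> \<rho> `` {a}. \<Union>y \<in> \<rho> `` {b}. \<rho> `` {x \<otimes> y}) = \<rho> `` {a \<otimes> b}"
    by (intro UN_constant_eq ballI)
  then show ?thesis by (simp add: quotient_monoid_def)
qed

lemma carrier_quotient_monoid: "carrier (quotient_monoid S \<rho>) = (\<lambda>a. \<rho> `` {a}) ` carrier S"
  by (auto simp: quotient_monoid_def quotient_def)

lemma quotient_monoid_monoid:
  fixes S (structure)
  assumes c: "congruence S \<rho>" and S: "monoid S"
  shows "monoid (quotient_monoid S \<rho>)"
proof -
  interpret monoid S by fact
  have one: "\<one>\<^bsub>quotient_monoid S \<rho>\<^esub> = \<rho> `` {\<one>}" by (simp add: quotient_monoid_def)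
  show ?thesis
    by (rule monoidI, unfold one carrier_quotient_monoid)
      (auto simp del: Image_singleton_iff simp: quotient_monoid_mult[OF c S] m_assoc)
qed

section \<open>The free inverse monoid\<close>

lemma word_monoid_monoid: "monoid (word_monoid X)"
  by (rule monoidI) (auto simp: word_monoid_def)

lemma word_inv_in_lists: "w \<in> lists (X \<times> UNIV) \<Longrightarrow> word_inv w \<in> lists (X \<times> UNIV)"
  by (auto simp: word_inv_def in_lists_conv_set)

lemma word_inv_word_inv: "word_inv (word_inv w) = w"
  by (simp add: word_inv_def rev_map o_def case_prod_unfold)

text \<open>The two families of Vagner pairs are, on classes of words, the regularity and
  commutation hypotheses of \<open>inverse_monoidI\<close>.\<close>

lemma inverse_monoid_FIM: "inverse_monoid (FIM X)"
proof -
  define W V where "W = word_monoid X" and "V = generated_congruence W (vagner_relation X)"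
  have W: "monoid W" "carrier W = lists (X \<times> UNIV)" "\<And>u v. u \<otimes>\<^bsub>W\<^esub> v = u @ v"
    by (simp_all add: W_def word_monoid_monoid) (simp_all add: word_monoid_def)
  have "vagner_relation X \<subseteq> carrier W \<times> carrier W"
    by (force simp: vagner_relation_def W(2) word_inv_def lists_eq_set)
  then have V: "congruence W V" using generated_congruence_congruence W(1) by (simp add: V_def)
  then have eq: "equiv (carrier W) V" by (simp add: congruence_def)
  have FIM: "FIM X = quotient_monoid W V" by (simp add: FIM_def W_def V_def)
  have mult: "V `` {u} \<otimes>\<^bsub>FIM X\<^esub> V `` {v} = V `` {u @ v}"
    if "u \<in> lists (X \<times> UNIV)" "v \<in> lists (X \<times> UNIV)" for u v
    using quotient_monoid_mult[OF V W(1)] that by (simp add: FIM W)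
  have vag: "V `` {u} = V `` {v}" if "(u, v) \<in> vagner_relation X" for u v
    using that subset_generated_congruence equiv_class_eq[OF eq] V_def by blast
  \<comment> \<open>One word \<open>w\<close> represents both classes at once; symmetry holds
    because \<open>word_inv\<close> is an involution.\<close>
  define P where "P a b \<longleftrightarrow>
    (\<exists>w \<in> lists (X \<times> UNIV). a = V `` {w} \<and> b = V `` {word_inv w})" for a b
  show ?thesis
  proof (rule inverse_monoidI[where P = P])
    show "monoid (FIM X)" using quotient_monoid_monoid[OF V W(1)] by (simp add: FIM)
  next
    fix a b assume "P a b"
    then show "a \<in> carrier (FIM X) \<and> b \<in> carrier (FIM X)"
      using word_inv_in_lists by (fastforce simp: P_def FIM carrier_quotient_monoid W)
    show "P b a" using \<open>P a b\<close> word_inv_in_lists word_inv_word_inv by (metis P_def)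
    obtain w where w: "w \<in> lists (X \<times> UNIV)" "a = V `` {w}" "b = V `` {word_inv w}"
      using \<open>P a b\<close> by (auto simp: P_def)
    have "V `` {w @ word_inv w @ w} = V `` {w}"
      by (rule vag) (use w in \<open>auto simp: vagner_relation_def\<close>)
    then show "a \<otimes>\<^bsub>FIM X\<^esub> b \<otimes>\<^bsub>FIM X\<^esub> a = a" using w word_inv_in_lists[OF w(1)] by (simp add: mult)
  next
    fix a assume "a \<in> carrier (FIM X)"
    then show "\<exists>b. P a b" by (auto simp: P_def FIM carrier_quotient_monoid W)
  next
    fix a b c d assume "P a b" "P c d"
    then obtain u v where u: "u \<in> lists (X \<times> UNIV)" "a = V `` {u}" "b = V `` {word_inv u}"
      and v: "v \<in> lists (X \<times> UNIV)" "c = V `` {v}" "d = V `` {word_inv v}"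
      by (auto simp: P_def)
    have "V `` {u @ word_inv u @ v @ word_inv v} = V `` {v @ word_inv v @ u @ word_inv u}"
      by (rule vag) (use u v in \<open>auto simp: vagner_relation_def\<close>)
    then show "(a \<otimes>\<^bsub>FIM X\<^esub> b) \<otimes>\<^bsub>FIM X\<^esub> (c \<otimes>\<^bsub>FIM X\<^esub> d) = (c \<otimes>\<^bsub>FIM X\<^esub> d) \<otimes>\<^bsub>FIM X\<^esub> (a \<otimes>\<^bsub>FIM X\<^esub> b)"
      using u v word_inv_in_lists[OF u(1)] word_inv_in_lists[OF v(1)] by (simp add: mult)
  qed
qed

section \<open>Presentations\<close>

text \<open>The quotient map followed by the inverse of the given isomorphism \<open>\<phi>\<close>,
  which runs from \<open>M\<close> to the quotient, allows working in \<open>M\<close> instead of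
  with classes.\<close>

lemma presents_projection:
  assumes "presents X R M"
  obtains h where "h \<in> hom (FIM X) M" "h ` carrier (FIM X) = carrier M"
    "\<And>a b. a \<in> carrier (FIM X) \<Longrightarrow> b \<in> carrier (FIM X) \<Longrightarrow>
      (a, b) \<in> pres_congruence X R \<longleftrightarrow> h a = h b"
proof -
  define S \<rho> where "S = FIM X" and "\<rho> = pres_congruence X R"
  interpret S: inverse_monoid S unfolding S_def by (rule inverse_monoid_FIM)
  interpret M: inverse_monoid M using assms by (simp add: presents_def)
  have "congruence S \<rho>"
    using generated_congruence_congruence[OF S.monoid_axioms] assms
    by (simp add: presents_def pres_congruence_def S_def \<rho>_def)
  note mult = quotient_monoid_mult[OF this S.monoid_axioms]
  have eq: "equiv (carrier S) \<rho>" using \<open>congruence S \<rho>\<close> by (simp add: congruence_def)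
  obtain \<phi> where \<phi>: "\<phi> \<in> hom M (quotient_monoid S \<rho>)"
    "bij_betw \<phi> (carrier M) (carrier (quotient_monoid S \<rho>))"
    using assms by (auto simp: presents_def is_iso_def iso_def S_def \<rho>_def)
  define h where "h a = inv_into (carrier M) \<phi> (\<rho> `` {a})" for a
  have h: "h a \<in> carrier M" "\<phi> (h a) = \<rho> `` {a}" if "a \<in> carrier S" for a
  proof -
    have "\<rho> `` {a} \<in> \<phi> ` carrier M"
      using that \<phi>(2) by (simp add: bij_betw_def carrier_quotient_monoid)
    then show "h a \<in> carrier M" "\<phi> (h a) = \<rho> `` {a}"
      unfolding h_def by (rule inv_into_into, rule f_inv_into_f)
  qed
  \<comment> \<open>By injectivity of \<open>\<phi>\<close> this characterises \<open>h a\<close>;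
    the homomorphism property and surjectivity both follow from it.\<close>
  have hI: "h a = m" if "m \<in> carrier M" "\<phi> m = \<rho> `` {a}" for a m
    using that \<phi>(2) by (metis bij_betw_inv_into_left h_def)
  show thesis
  proof
    show "h \<in> hom (FIM X) M"
      unfolding S_def[symmetric]
      by (rule homI) (auto intro!: hI simp: h hom_mult[OF \<phi>(1)] mult)
    have "m \<in> h ` carrier S" if "m \<in> carrier M" for m
    proof -
      have "\<phi> m \<in> carrier (quotient_monoid S \<rho>)" using \<phi>(1) that by (rule hom_in_carrier)
      then show ?thesis using hI[OF that] by (auto simp: carrier_quotient_monoid)
    qed
    then show "h ` carrier (FIM X) = carrier M" unfolding S_def[symmetric] using h by auto
    show "(a, b) \<in> pres_congruence X R \<longleftrightarrow> h a = h b"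
      if "a \<in> carrier (FIM X)" "b \<in> carrier (FIM X)" for a b
      using that eq_equiv_class_iff[OF eq, of a b] h[of a] h[of b] unfolding S_def[symmetric] \<rho>_def[symmetric]
      by (metis h_def)
  qed
qed

theorem proposition4p2:
  fixes X :: "'x set" and R :: "'x word set rel" and M :: "('m, 'b) monoid_scheme"
  assumes "presents X R M"
  shows "(E_unitary M \<longleftrightarrow>
            inverse_submonoid (FIM X) (pres_kernel X R) \<and> upward_closed (FIM X) (pres_kernel X R))
       \<and> (E_unitary M \<longrightarrow> pres_kernel X R = upward_closure (FIM X) (pres_normal X R))"
proof -
  define S where "S = FIM X"
  interpret S: inverse_monoid S unfolding S_def by (rule inverse_monoid_FIM)
  have M: "inverse_monoid M" and R: "R \<subseteq> carrier S \<times> carrier S"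
    using assms by (auto simp: presents_def S_def)
  interpret M: inverse_monoid M by (rule M)
  obtain h where h: "h \<in> hom S M" and surj: "h ` carrier S = carrier M"
    and \<rho>: "\<And>a b. a \<in> carrier S \<Longrightarrow> b \<in> carrier S \<Longrightarrow> (a, b) \<in> pres_congruence X R \<longleftrightarrow> h a = h b"
    using presents_projection[OF assms] unfolding S_def by metis
  define K where "K = pres_kernel X R"
  have K_eq: "K = {s \<in> carrier S. h s \<in> idempotents M}"
    using S.congruence_kernel_eq[OF M h \<rho>] by (simp add: K_def pres_kernel_def S_def)
  \<comment> \<open>Normality yields the inverse submonoid part of the claim, and later
    \<open>N \<subseteq> K\<close>.\<close>
  have K: "normal_inverse_subsemigroup S K"
    unfolding K_eq by (rule S.kernel_normal[OF M h])
  have unitary: "E_unitary M \<longleftrightarrow> upward_closed S K"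
    unfolding K_eq by (rule S.E_unitary_iff_kernel_closed[OF M h surj])
  define A where "A = (\<Union>(l, r) \<in> R. {sinv S l \<otimes>\<^bsub>S\<^esub> r, l \<otimes>\<^bsub>S\<^esub> sinv S r})"
  define N where "N = normal_inverse_hull S A"
  have N_eq: "N = pres_normal X R" by (simp add: N_def A_def pres_normal_def S_def)
  have A: "A \<subseteq> carrier S" using R by (auto simp: A_def)
  have N: "normal_inverse_subsemigroup S N" unfolding N_def by (rule S.normal_inverse_hull_normal[OF A])
  then have Nsub: "N \<subseteq> carrier S"
    by (simp add: normal_inverse_subsemigroup_def inverse_subsemigroup_def)
  \<comment> \<open>Both sides of a relation have the same image \<open>m\<close> under
    \<open>h\<close>, so the two generators map to the idempotents \<open>m\<^sup>\<star> m\<close>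
    and \<open>m m\<^sup>\<star>\<close>.\<close>
  have "A \<subseteq> K"
  proof -
    have "sinv S l \<otimes>\<^bsub>S\<^esub> r \<in> K \<and> l \<otimes>\<^bsub>S\<^esub> sinv S r \<in> K" if lr: "(l, r) \<in> R" for l r
    proof -
      have c: "l \<in> carrier S" "r \<in> carrier S" using R lr by auto
      have "(l, r) \<in> pres_congruence X R"
        using lr subset_generated_congruence by (auto simp: pres_congruence_def)
      then have "h l = h r" using \<rho> c by blast
      then show ?thesis
        using c h hom_in_carrier[OF h c(2)] M.sinv_mult_idempotent M.mult_sinv_idempotent
        by (simp add: K_eq hom_mult S.hom_sinv[OF M h])
    qed
    then show ?thesis by (auto simp: A_def)
  qed
  then have "N \<subseteq> K" using K by (auto simp: N_def normal_inverse_hull_def)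
  then have "upward_closure S N \<subseteq> K" if "upward_closed S K"
    using that by (auto simp: upward_closure_def)
  \<comment> \<open>The closure of \<open>N\<close> is closed and normal and contains every
    \<open>l r\<^sup>\<star>\<close>, so it may serve as the set \<open>C\<close> of
    \<open>kernel_subset_closed_normal\<close>.\<close>
  moreover have "K \<subseteq> upward_closure S N"
    unfolding K_def pres_kernel_def pres_congruence_def S_def[symmetric]
  proof (rule S.kernel_subset_closed_normal[OF S.upward_closure_normal[OF N]
        S.upward_closure_closed[OF Nsub] R])
    fix l r assume "(l, r) \<in> R"
    then have "l \<otimes>\<^bsub>S\<^esub> sinv S r \<in> A" by (auto simp: A_def)
    then show "l \<otimes>\<^bsub>S\<^esub> sinv S r \<in> upward_closure S N"
      by (auto simp: N_def normal_inverse_hull_def upward_closure_def)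
  qed
  ultimately show ?thesis
    using unitary S.normal_inverse_submonoid[OF K] unfolding K_def N_eq S_def by blast
qed

end
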